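(* Let $m\ge 0$ be an integer and $v_i=v^{d_i}$ with $d_i$ a positive integer. The following identities hold in $\mathbb Q(v)$. (1) For all integers $b,\ell$ with $0\le |b|\le m$ and $0\le\ell\le m$, $$\sum_{k=0}^{m}\sum_{s=0}^{2k}[b(2\ell+1-4k+4s)]_{v_i}\begin{bmatrix}2m+1\\ 2k\end{bmatrix}_{v_i}\left(\begin{bmatrix}2k-1\\ s\end{bmatrix}_{v_i^2}+\begin{bmatrix}2k-1\\ s-1\end{bmatrix}_{v_i^2}\right)\begin{bmatrix}2m-2k+1\\ m-\ell-s\end{bmatrix}_{v_i^2}=0.$$ (2) For all integers $b,\ell$ with $0\le |b|\le m$ and $0\le\ell\le m$, $$\sum_{k=0}^{m}\sum_{s=0}^{2k+1}[b(2\ell-1-4k+4s)]_{v_i}\begin{bmatrix}2m+1\\ 2k+1\end{bmatrix}_{v_i}\left(\begin{bmatrix}2k\\ s\end{bmatrix}_{v_i^2}+\begin{bmatrix}2k\\ s-1\end{bmatrix}_{v_i^2}\right)\begin{bmatrix}2m-2k\\ m-\ell-s\end{bmatrix}_{v_i^2}=0.$$ (3) For all integers $b,\ell$ with $-(m+1)\le b\le m$ and $0\le\ell\le m$, $$\sum_{k,s\ge0}v_i^{(2b+1)(2\ell-2k+2s+1)}\begin{bmatrix}2m+2\\ 2k+1\end{bmatrix}_{v_i}\left(\begin{bmatrix}2k\\ s\end{bmatrix}_{v_i^2}+\begin{bmatrix}2k\\ s-1\end{bmatrix}_{v_i^2}\right)\begin{bmatrix}2m-2k+1\\ m-\ell-s\end{bmatrix}_{v_i^2}$$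 $$=\sum_{k,s\ge0}v_i^{(2b+1)(2k-2s)}\begin{bmatrix}2m+2\\ 2k\end{bmatrix}_{v_i}\left(\begin{bmatrix}2k-1\\ s\end{bmatrix}_{v_i^2}+\begin{bmatrix}2k-1\\ s-1\end{bmatrix}_{v_i^2}\right)\begin{bmatrix}2m-2k+2\\ m-\ell-s\end{bmatrix}_{v_i^2}.$$
   Context: $v$ is an indeterminate. For an integer $n$, $[n]=\frac{v^n-v^{-n}}{v-v^{-1}}$; $[m]^!=\prod_{s=1}^m[s]$, $[0]^!=1$. For arbitrary integers $n,d$ (the upper entry may be negative): $\begin{bmatrix}n\\ d\end{bmatrix}=\frac{[n][n-1]\cdots[n-d+1]}{[d]^!}$ if $d>0$, $=1$ if $d=0$, $=0$ if $d<0$. A subscript $c$, as in $[n]_c$ or $\begin{bmatrix}n\\ d\end{bmatrix}_c$, denotes evaluation at $v=c$. All sums over $k,s\ge0$ have only finitely many nonzero terms. *)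

theory Defs
  imports
    "HOL-Computational_Algebra.Polynomial"
    "HOL-Computational_Algebra.Fraction_Field"
    "HOL-Library.Groups_Big_Fun"
begin

type_synonym ratfun = "rat poly fract"

definition v_indet :: ratfun where
  "v_indet = Fract [:0, 1:] 1"

(* The first argument c is the subscript: the quantum integer [n] evaluated at v = c.
   Evaluation is plain substitution, so the definitions are meant for c that are not roots
   of unity (otherwise a denominator vanishes); positive powers of v_indet are of this kind. *)

definition qint :: "'a::field \<Rightarrow> int \<Rightarrow> 'a" where
  "qint c n = (c powi n - c powi (- n)) / (c - c powi (- 1))"

definition qfact :: "'a::field \<Rightarrow> nat \<Rightarrow> 'a" where
  "qfact c m = (\<Prod>s=1..m. qint c (int s))"

definition qbinom :: "'a::field \<Rightarrow> int \<Rightarrow> int \<Rightarrow> 'a" where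
  "qbinom c n d =
    (if d > 0 then (\<Prod>j<nat d. qint c (n - int j)) / qfact c (nat d)
     else if d = 0 then 1 else 0)"

lemma qbinom_neg: "d < 0 \<Longrightarrow> qbinom c n d = 0"
  by (simp add: qbinom_def)

lemma qbinom_eq_0:
  assumes "int n < d"
  shows "qbinom c (int n) d = 0"
proof -
  have "n \<in> {..<nat d}" "qint c (int n - int n) = 0"
    using assms by (auto simp: qint_def)
  then have "(\<Prod>j<nat d. qint c (int n - int j)) = 0"
    by (meson finite_lessThan prod_zero)
  then show ?thesis
    using assms by (simp add: qbinom_def)
qed

(* The sums over all k, s >= 0 are rendered with Sum_any, which is 0 by convention on infinite
   support. This lemma shows that the support is finite for every sum of the shape used here. *)
lemma finite_support_qbinom:
  fixes p :: "nat \<Rightarrow> int"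
  assumes "\<And>k. int k \<le> p k"
  shows "finite {(k, s). x k s * qbinom c (int n) (p k) * y k s * qbinom e (u k) (a - int s) \<noteq> 0}"
proof (rule finite_subset)
  show "{(k, s). x k s * qbinom c (int n) (p k) * y k s * qbinom e (u k) (a - int s) \<noteq> 0}
      \<subseteq> {..n} \<times> {..nat a}"
  proof safe
    fix k s :: nat
    assume ne: "x k s * qbinom c (int n) (p k) * y k s * qbinom e (u k) (a - int s) \<noteq> 0"
    then have "\<not> int n < p k" "\<not> a - int s < 0"
      using qbinom_eq_0[of n "p k" c] qbinom_neg[of "a - int s" e "u k"] by auto
    with assms[of k] show "k \<le> n" "s \<le> nat a"
      by linarith+
  qed
qed simp

end

(* Write w = v^2, {n} = v^n - v^(-n) and K(j,s) = [j-1; s]_w + [j-1; s-1]_w. All three identities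
   rest on the linearization formula
     sum_t [N; j]_v K(j, d-t) [N-j; t]_w = [N; d]_v [N; e]_v,   where j = d + e - 2t.
   Both sides X_N(d,e) satisfy the recurrences
     {N-d-e} X_N(d,e) = {N} (X_(N-1)(d,e) - X_(N-1)(d-1,e-1)),
     {d-e} X_N(d,e) = {N} (X_(N-1)(d-1,e) - X_(N-1)(d,e-1)),
   which hold on the left term by term. Induction on N settles everything except N = 2d = 2e, and
   this last value follows since the alternating sums of both sides over d + e = N agree.
   Substituting d = m - l and e = j + d - 2s, each double sum becomes [N; d] times a sum over the e
   of one parity. The reflection e -> N - e and the vanishing of
   sum_e (-1)^e v^(Be) [N; e] = prod_i (1 - v^(B+N-1-2i)) finish the proof. *)

theory Submission
  imports Defs
begin

section \<open>Brackets, the kernel and two facts on alternating sums\<close>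

text \<open>Numerators of the quantum integers; working with them avoids divisions.\<close>

definition br :: "'a::field \<Rightarrow> int \<Rightarrow> 'a" where
  "br c n = c powi n - c powi (- n)"

definition br_plus :: "'a::field \<Rightarrow> int \<Rightarrow> 'a" where
  "br_plus c n = c powi n + c powi (- n)"

lemma br_plus_minus: "br_plus c (- n) = br_plus c n" by (simp add: br_plus_def)

lemma br_0 [simp]: "br c 0 = 0" by (simp add: br_def)

lemma br_minus: "br c (- n) = - br c n" by (simp add: br_def)

lemma br_square: "br (c ^ 2) n = br c (2 * n)"
  by (simp add: br_def power_int_mult power_int_minus)

lemma qint_eq_br: "qint c n = br c n / br c 1"
  by (simp add: qint_def br_def)

lemma qbinom_0 [simp]: "qbinom c n 0 = 1" by (simp add: qbinom_def)

lemma qbinom_nat_Suc: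
  "qbinom c n (int (Suc k)) = qbinom c n (int k) * (qint c (n - int k) / qint c (int (Suc k)))"
  by (cases "k = 0") (simp_all add: qbinom_def qfact_def nat_add_distrib ac_simps)

lemma qbinom_zero_left: "qbinom c 0 d = (if d = 0 then 1 else 0)"
  using qbinom_eq_0[of 0 d c] by (cases d "0::int" rule: linorder_cases) (auto simp: qbinom_neg)

text \<open>The kernel \<open>K\<close> of the overview is \<open>pair_qbinom (c\<^sup>2)\<close>.
  Two summands are kept instead of the quotient
  \<open>(br c s + br c (j - s)) / br c j * qbinom c j s\<close>, which breaks down at
  \<open>j = 0\<close>.\<close>

definition pair_qbinom :: "'a::field \<Rightarrow> int \<Rightarrow> int \<Rightarrow> 'a" where
  "pair_qbinom c j s = qbinom c (j - 1) s + qbinom c (j - 1) (s - 1)"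

text \<open>Makes alternating sums of \<open>pair_qbinom\<close> over its lower entry collapse to
  boundary terms.\<close>

lemma alternating_telescope:
  fixes g :: "int \<Rightarrow> 'b::comm_ring_1"
  shows "(\<Sum>i\<le>M. (- 1) ^ i * (g (int i) + g (int i - 1))) = (- 1) ^ M * g (int M) + g (- 1)"
  by (induction M) (simp_all add: algebra_simps)

text \<open>Multiplying by \<open>(- 1) ^ q\<close> at most exchanges the names of the parity
  classes; the shift \<open>q\<close> lets parity be measured relative to another index.\<close>

lemma sum_even_eq_sum_odd:
  fixes f :: "nat \<Rightarrow> 'b::comm_ring_1"
  assumes "(\<Sum>e\<le>N. (- 1) ^ e * f e) = 0"
  shows "(\<Sum>e | e \<le> N \<and> even (e + q). f e) = (\<Sum>e | e \<le> N \<and> odd (e + q). f e)"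
proof -
  have "0 = (- 1) ^ q * (\<Sum>e\<le>N. (- 1) ^ e * f e)" using assms by simp
  also have "\<dots> = (\<Sum>e\<le>N. (- 1) ^ (e + q) * f e)" by (simp add: sum_distrib_left power_add mult_ac)
  also have "{..N} = {e. e \<le> N \<and> even (e + q)} \<union> {e. e \<le> N \<and> odd (e + q)}" by auto
  also have "(\<Sum>e\<in>\<dots>. (- 1) ^ (e + q) * f e) 
    = (\<Sum>e | e \<le> N \<and> even (e + q). (- 1) ^ (e + q) * f e) + (\<Sum>e | e \<le> N \<and> odd (e + q). (- 1) ^ (e + q) * f e)"
    by (rule sum.union_disjoint) auto
  also have "\<dots> = (\<Sum>e | e \<le> N \<and> even (e + q). f e) - (\<Sum>e | e \<le> N \<and> odd (e + q). f e)"
    unfolding diff_conv_add_uminus sum_negf[symmetric]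
    by (intro arg_cong2[where f = "(+)"] sum.cong refl) auto
  finally show ?thesis by simp
qed

section \<open>Quantum binomials away from roots of unity\<close>

text \<open>Every \<open>br c n\<close> with \<open>n \<noteq> 0\<close> can be cancelled here, and
  the hypotheses pass on to \<open>c\<^sup>2\<close>, so both bases in the identities are
  covered.\<close>

locale non_root_of_unity =
  fixes c :: "'a::field"
  assumes nonzero [simp]: "c \<noteq> 0" and power_neq_1: "n > 0 \<Longrightarrow> c ^ n \<noteq> 1"
begin

lemma square: "non_root_of_unity (c ^ 2)"
proof
  fix n :: nat assume "n > 0"
  then show "(c ^ 2) ^ n \<noteq> 1"
    using power_neq_1[of "2 * n"] by (simp add: power_mult)
qed simp

lemma br_eq_0_iff [simp]: "br c n = 0 \<longleftrightarrow> n = 0"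
proof -
  have *: "br c (int k) \<noteq> 0" if "k > 0" for k
  proof
    assume "br c (int k) = 0"
    then have "c ^ (2 * k) = 1"
      by (simp add: br_def power_int_minus field_simps mult_2 mult_2_right power_add)
    with that power_neq_1[of "2 * k"] show False by simp
  qed
  show ?thesis
  proof (cases "n \<ge> 0")
    case True
    then show ?thesis using *[of "nat n"] by (cases "n = 0") auto
  next
    case False
    then show ?thesis using *[of "nat (- n)"] by (auto simp: br_minus)
  qed
qed

text \<open>The recursion in the lower entry with denominators cleared. In this form it includes
  \<open>d \<le> 0\<close>, where both sides are zero.\<close>

lemma br_mult_qbinom: "br c d * qbinom c n d = br c (n - d + 1) * qbinom c n (d - 1)"
proof (cases "d > 0")
  case True
  then obtain k where "d = int (Suc k)"
    by (metis Suc_pred' zero_less_imp_eq_int)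
  then show ?thesis
    by (simp only: qbinom_nat_Suc qint_eq_br) (simp add: field_simps)
next
  case False
  then show ?thesis by (cases "d = 0") (simp_all add: qbinom_neg)
qed

text \<open>Absorption for upper entries of any sign, hence by induction on \<open>d\<close> and not
  from a factorial formula. Each step multiplies by \<open>br c (int (Suc k))\<close> and cancels it
  again.\<close>

lemma br_upper_mult_qbinom: "br c n * qbinom c (n - 1) d = br c (n - d) * qbinom c n d"
proof (cases "d \<ge> 0")
  case True
  then obtain k where d: "d = int k" using nonneg_int_cases by blast
  show ?thesis unfolding d
  proof (induction k)
    case (Suc k)
    have "br c n * (br c (int (Suc k)) * qbinom c (n - 1) (int (Suc k)))
      = br c (n - int (Suc k)) * (br c n * qbinom c (n - 1) (int k))"
      by (subst br_mult_qbinom) (simp add: algebra_simps)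
    also have "\<dots> = br c (n - int (Suc k)) * (br c (n - int k) * qbinom c n (int k))"
      by (simp only: Suc.IH)
    also have "\<dots> = br c (n - int (Suc k)) * (br c (int (Suc k)) * qbinom c n (int (Suc k)))"
      by (subst br_mult_qbinom[of "int (Suc k)"]) (simp add: algebra_simps)
    finally show ?case
      by (simp add: mult.left_commute[of _ "br c (1 + int k)"])
  qed simp
qed (simp add: qbinom_neg)

lemma br_upper_mult_qbinom_pred: "br c n * qbinom c (n - 1) (d - 1) = br c d * qbinom c n d"
  using br_upper_mult_qbinom[of n "d - 1"] br_mult_qbinom[of d n]
  by (simp add: algebra_simps)

text \<open>Both terms on the right become multiples of \<open>qbinom c (n + 1) d\<close> by
  absorption, after multiplication by \<open>br c (n + 1)\<close>. Cancelling this factor uses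
  \<open>n \<noteq> -1\<close>.\<close>

lemma pascal: "qbinom c (n + 1) d = c powi d * qbinom c n d + c powi (d - 1 - n) * qbinom c n (d - 1)"
  if "n \<noteq> -1"
proof -
  have "br c (n + 1) * (c powi d * qbinom c n d + c powi (d - 1 - n) * qbinom c n (d - 1))
    = c powi d * (br c (n + 1) * qbinom c (n + 1 - 1) d)
      + c powi (d - 1 - n) * (br c (n + 1) * qbinom c (n + 1 - 1) (d - 1))"
    by (simp add: algebra_simps)
  also have "\<dots> = (c powi d * br c (n + 1 - d) + c powi (d - 1 - n) * br c d) * qbinom c (n + 1) d"
    unfolding br_upper_mult_qbinom_pred unfolding br_upper_mult_qbinom by (simp add: algebra_simps)
  also have "c powi d * br c (n + 1 - d) + c powi (d - 1 - n) * br c d = br c (n + 1)"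
    by (simp add: br_def power_int_diff power_int_add power_int_minus field_simps)
  finally show ?thesis using that by simp
qed

lemma qbinom_diag: "qbinom c (int n) (int n) = 1"
proof (induction n)
  case (Suc n)
  then show ?case using br_upper_mult_qbinom_pred[of "int (Suc n)" "int (Suc n)"] by simp
qed simp

text \<open>Passing from \<open>k\<close> to \<open>k + 1\<close> changes both sides by the same
  factor \<open>br c (n - k) / br c (k + 1)\<close>.\<close>

lemma qbinom_symmetric: 
  assumes "k \<le> n" shows "qbinom c (int n) (int n - int k) = qbinom c (int n) (int k)"
  using assms
proof (induction k)
  case 0
  then show ?case by (simp add: qbinom_diag)
next
  case (Suc k)
  have "br c (int (Suc k)) * qbinom c (int n) (int n - int (Suc k)) 
      = br c (int n - int k) * qbinom c (int n) (int n - int k)"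
    using br_mult_qbinom[of "int n - int k" "int n"] by (simp add: algebra_simps)
  also have "\<dots> = br c (int (Suc k)) * qbinom c (int n) (int (Suc k))"
    using br_mult_qbinom[of "int (Suc k)" "int n"] Suc by simp
  finally show ?case by simp
qed


section \<open>Product formulas and difference equations in base \<open>c\<^sup>2\<close>\<close>

text \<open>\<open>br\<close> and \<open>br_plus\<close> behave like twice the hyperbolic sine and
  cosine; this and the next two lemmas are their product and duplication formulas.\<close>

lemma br_mult_br: "br c x * br c y = br_plus c (x + y) - br_plus c (x - y)"
  by (simp add: br_def br_plus_def power_int_diff power_int_add power_int_minus divide_inverse algebra_simps)

lemma br_mult_br_plus: "br c x * br_plus c y = br c (x + y) + br c (x - y)"
  by (simp add: br_def br_plus_def power_int_diff power_int_add power_int_minus divide_inverse algebra_simps)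

lemma br_double: "br c (2 * x) = br c x * br_plus c x"
  using br_mult_br_plus[of x x] by simp

text \<open>Absorption in base \<open>c\<^sup>2\<close> produces \<open>br (c\<^sup>2) (n - t) - br
  (c\<^sup>2) t = br_plus c n * br c (n - 2 * t)\<close>, and
  \<open>br (c\<^sup>2) n = br c n * br_plus c n\<close>. With \<open>n = N - j\<close> this drives
  the first recurrence of the overview.\<close>

lemma qbinom_sq_diff:
  "br c (n - 2 * t) * qbinom (c\<^sup>2) n t = br c n * (qbinom (c\<^sup>2) (n - 1) t - qbinom (c\<^sup>2) (n - 1) (t - 1))"
proof (cases "n = 0")
  case True
  then show ?thesis using qbinom_eq_0[of 0 t "c\<^sup>2"] by (cases t "0::int" rule: linorder_cases) (auto simp: qbinom_neg)
next
  case False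
  interpret sq: non_root_of_unity "c\<^sup>2" by (rule square)
  have "br (c\<^sup>2) n * (br c n * (qbinom (c\<^sup>2) (n - 1) t - qbinom (c\<^sup>2) (n - 1) (t - 1)))
    = br c n * (br (c\<^sup>2) n * qbinom (c\<^sup>2) (n - 1) t - br (c\<^sup>2) n * qbinom (c\<^sup>2) (n - 1) (t - 1))"
    by (simp add: algebra_simps)
  also have "\<dots> = br c n * (br (c\<^sup>2) (n - t) - br (c\<^sup>2) t) * qbinom (c\<^sup>2) n t"
    unfolding sq.br_upper_mult_qbinom_pred unfolding sq.br_upper_mult_qbinom by (simp add: algebra_simps)
  also have "br c n * (br (c\<^sup>2) (n - t) - br (c\<^sup>2) t) = br (c\<^sup>2) n * br c (n - 2 * t)"
  proof -
    have "br c (2 * (n - t)) - br c (2 * t) = br_plus c n * br c (n - 2 * t)"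
      using br_mult_br_plus[of "n - 2 * t" n] br_minus[of c "2 * t"] by (simp add: algebra_simps)
    then show ?thesis unfolding br_square br_double[of n] by simp
  qed
  finally show ?thesis using False by (simp add: mult.assoc)
qed

text \<open>The upper entry is \<open>-1\<close> here: for \<open>s \<noteq> 0\<close> the two
  coefficients cancel by the recursion in the lower entry.\<close>

lemma pair_qbinom_0: "pair_qbinom c 0 s = (if s = 0 then 1 else 0)"
proof (cases "s = 0")
  case False
  have "br c s * qbinom c (- 1) s = - br c s * qbinom c (- 1) (s - 1)"
    using br_mult_qbinom[of s "- 1"] by (simp add: br_minus)
  then have "br c s * pair_qbinom c 0 s = 0"
    by (simp add: pair_qbinom_def distrib_left)
  with False show ?thesis by simp
qed (simp add: pair_qbinom_def qbinom_neg)

lemma pair_qbinom_eq_0: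
  assumes "s < 0 \<or> 0 \<le> j \<and> j < s"
  shows "pair_qbinom c j s = 0"
proof (cases "s < 0 \<or> j = 0")
  case True
  then show ?thesis using assms pair_qbinom_0[of s] by (auto simp: pair_qbinom_def qbinom_neg)
next
  case False
  then show ?thesis
    using assms qbinom_eq_0[of "nat (j - 1)" s c] qbinom_eq_0[of "nat (j - 1)" "s - 1" c] 
    by (simp add: pair_qbinom_def)
qed

lemma br_mult_pair_qbinom:
  "br c j * pair_qbinom c j s = (br c s + br c (j - s)) * qbinom c j s"
  using br_upper_mult_qbinom[of j s] br_upper_mult_qbinom_pred[of j s]
  by (simp add: pair_qbinom_def algebra_simps)

text \<open>Drives the second recurrence, where \<open>2 * s - j\<close> becomes
  \<open>d - e\<close>. The closed form of the kernel is used at \<open>j\<close> and at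
  \<open>j - 1\<close>, so \<open>j = 0\<close> and \<open>j = 1\<close> are treated
  separately.\<close>

lemma pair_qbinom_sq_diff:
  "br c (2 * s - j) * pair_qbinom (c\<^sup>2) j s
    = br c j * (pair_qbinom (c\<^sup>2) (j - 1) (s - 1) - pair_qbinom (c\<^sup>2) (j - 1) s)"
proof -
  interpret sq: non_root_of_unity "c\<^sup>2" by (rule square)
  consider "j = 0" | "j = 1" | "j \<noteq> 0" "j \<noteq> 1" by blast
  then show ?thesis
  proof cases
    case 1
    then show ?thesis by (simp add: sq.pair_qbinom_0)
  next
    case 2
    then show ?thesis 
      by (simp add: sq.pair_qbinom_0 pair_qbinom_def[of _ 1] qbinom_zero_left br_minus[of c 1, simplified])
  next
    case 3
    let ?B = "br (c\<^sup>2)" and ?q = "qbinom (c\<^sup>2)" and ?K = "pair_qbinom (c\<^sup>2)"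
    have "?B j * (?B (j - 1) * (br c j * (?K (j - 1) (s - 1) - ?K (j - 1) s)))
      = br c j * (?B j * (?B (j - 1) * ?K (j - 1) (s - 1)) - ?B j * (?B (j - 1) * ?K (j - 1) s))"
      by (simp add: algebra_simps)
    also have "\<dots> = br c j * ((?B (s - 1) + ?B (j - s)) * (?B j * ?q (j - 1) (s - 1))
        - (?B s + ?B (j - 1 - s)) * (?B j * ?q (j - 1) s))"
      unfolding sq.br_mult_pair_qbinom by (simp add: algebra_simps)
    also have "\<dots> = br c j * ((?B (s - 1) + ?B (j - s)) * ?B s - (?B s + ?B (j - 1 - s)) * ?B (j - s)) * ?q j s"
      unfolding sq.br_upper_mult_qbinom_pred unfolding sq.br_upper_mult_qbinom by (simp add: algebra_simps)
    also have "(?B (s - 1) + ?B (j - s)) * ?B s - (?B s + ?B (j - 1 - s)) * ?B (j - s)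
        = ?B (s - 1) * ?B s - ?B (j - 1 - s) * ?B (j - s)"
      by (simp add: algebra_simps)
    \<comment> \<open>Both products contribute the same \<open>br_plus c (- 2)\<close>; it cancels,
      and the remaining difference is again a product.\<close>
    also have "\<dots> = br c (2 * (j - 1)) * br c (2 * (2 * s - j))"
      unfolding br_square br_mult_br by (simp add: algebra_simps)
    also have "\<dots> = ?B (j - 1) * (br c (2 * s - j) * br_plus c (2 * s - j))"
      unfolding br_square br_double ..
    also have "br c j * \<dots> = ?B (j - 1) * br c (2 * s - j) * (br c j * br_plus c (2 * s - j))"
      by (simp only: ac_simps)
    also have "br c j * br_plus c (2 * s - j) = ?B s + ?B (j - s)"
      unfolding br_square br_mult_br_plus by (simp add: algebra_simps)
    also have "?B (j - 1) * br c (2 * s - j) * (?B s + ?B (j - s)) * ?q j s = ?B (j - 1) * br c (2 * s - j) * (?B j * ?K j s)"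
      unfolding sq.br_mult_pair_qbinom by (simp add: algebra_simps)
    finally show ?thesis using 3 by (simp add: mult_ac)
  qed
qed


section \<open>The q-binomial theorem and its consequences\<close>

text \<open>Induction with \<open>X\<close> replaced by \<open>smult c X\<close>: this raises all
  old exponents by one and leaves a single new factor with exponent \<open>- N\<close>. The
  coefficients then combine by \<open>pascal\<close>.\<close>

lemma q_binomial_theorem:
  fixes X :: "'a poly"
  shows "(\<Prod>i<N. 1 + smult (c powi (int N - 1 - 2 * int i)) X)
    = (\<Sum>k\<le>N. smult (qbinom c (int N) (int k)) (X ^ k))"
proof (induction N arbitrary: X)
  case (Suc N)
  let ?q = "\<lambda>k. qbinom c (int N) (int k)"
  have "(\<Prod>i<Suc N. 1 + smult (c powi (int (Suc N) - 1 - 2 * int i)) X)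
    = (\<Prod>i<N. 1 + smult (c powi (int N - 1 - 2 * int i)) (smult c X)) * (1 + smult (c powi (- int N)) X)"
  proof -
    have *: "c powi (int N - 2 * int i) = c powi (int N - 1 - 2 * int i) * c" for i
      using power_int_add_1[of c "int N - 1 - 2 * int i"] by simp
    show ?thesis by (simp flip: *)
  qed
  also have "\<dots> = (\<Sum>k\<le>N. smult (c powi int k * ?q k) (X ^ k))
      + (\<Sum>k\<le>N. smult (c powi (int k - int N) * ?q k) (X ^ Suc k))"
    unfolding Suc.IH distrib_left sum_distrib_right
    by (simp add: smult_power mult_ac power_int_diff power_int_minus divide_inverse)
  also have "(\<Sum>k\<le>N. smult (c powi int k * ?q k) (X ^ k)) = (\<Sum>k\<le>Suc N. smult (c powi int k * ?q k) (X ^ k))"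
    using qbinom_eq_0[of N "int (Suc N)" c] by simp
  also have "(\<Sum>k\<le>N. smult (c powi (int k - int N) * ?q k) (X ^ Suc k))
    = (\<Sum>k\<le>Suc N. smult (c powi (int k - 1 - int N) * qbinom c (int N) (int k - 1)) (X ^ k))"
    unfolding sum.atMost_Suc_shift by (simp add: qbinom_neg)
  also have "(\<Sum>k\<le>Suc N. smult (c powi int k * ?q k) (X ^ k)) + \<dots>
    = (\<Sum>k\<le>Suc N. smult (qbinom c (int (Suc N)) (int k)) (X ^ k))"
    unfolding sum.distrib[symmetric] smult_add_left[symmetric]
    by (rule sum.cong) (use pascal[of "int N"] in \<open>simp_all add: add.commute\<close>)
  finally show ?case .
qed simp

lemma coeff_q_binomial: 
  "coeff (\<Sum>k\<le>N. smult (qbinom c (int N) (int k)) (monom a m ^ k)) i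
    = (\<Sum>k\<le>N. if m * k = i then qbinom c (int N) (int k) * a ^ k else 0)"
  by (simp add: coeff_sum monom_power smult_monom if_distrib cong: if_cong)

text \<open>Compare the middle coefficients in \<open>\<Prod>(1 - c\<^sup>k x) (1 + c\<^sup>k x) = \<Prod>(1 - (c\<^sup>2)\<^sup>k x\<^sup>2)\<close>.\<close>

lemma alternating_sum_qbinom_squares:
  "(\<Sum>k\<le>2 * n. (- 1) ^ k * (qbinom c (int (2 * n)) (int k) * qbinom c (int (2 * n)) (int (2 * n) - int k)))
    = (- 1) ^ n * qbinom (c\<^sup>2) (int (2 * n)) (int n)"
proof -
  interpret sq: non_root_of_unity "c\<^sup>2" by (rule square)
  define N where "N = 2 * n"
  have "(\<Prod>i<N. 1 + smult (c powi (int N - 1 - 2 * int i)) (monom (- 1) 1))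
      * (\<Prod>i<N. 1 + smult (c powi (int N - 1 - 2 * int i)) (monom 1 1))
    = (\<Prod>i<N. 1 + smult (c\<^sup>2 powi (int N - 1 - 2 * int i)) (monom (- 1) 2))"
    unfolding prod.distrib[symmetric]
  proof (rule prod.cong)
    fix i
    have *: "(1 + monom (- a) 1) * (1 + monom a 1) = 1 + monom (- (a * a)) 2" for a :: 'a
      by (simp add: algebra_simps mult_monom minus_monom add_monom flip: one_add_one)
    show "(1 + smult (c powi (int N - 1 - 2 * int i)) (monom (- 1) 1)) *
        (1 + smult (c powi (int N - 1 - 2 * int i)) (monom 1 1)) =
      1 + smult (c\<^sup>2 powi (int N - 1 - 2 * int i)) (monom (- 1) 2)"
      using *[of "c powi (int N - 1 - 2 * int i)"] by (simp add: smult_monom power2_eq_square power_int_mult_distrib)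
  qed simp
  then have "coeff ((\<Sum>k\<le>N. smult (qbinom c (int N) (int k)) (monom (- 1) 1 ^ k))
      * (\<Sum>k\<le>N. smult (qbinom c (int N) (int k)) (monom 1 1 ^ k))) N
    = coeff (\<Sum>k\<le>N. smult (qbinom (c\<^sup>2) (int N) (int k)) (monom (- 1) 2 ^ k)) N"
    by (simp only: q_binomial_theorem sq.q_binomial_theorem)
  then show ?thesis
    unfolding coeff_mult coeff_q_binomial sq.coeff_q_binomial
    by (simp add: N_def sum.delta mult_ac of_nat_diff cong: if_cong)
qed

text \<open>At \<open>X = - (c powi B)\<close> the factor with exponent \<open>- B\<close> is zero.
  The assumptions on parity and size say that this exponent occurs; its index is
  \<open>r\<close>.\<close>

lemma q_binomial_vanishing:
  assumes "even (B + int N + 1)" "\<bar>B\<bar> < int N"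
  shows "(\<Sum>k\<le>N. (- 1) ^ k * (c powi (B * int k) * qbinom c (int N) (int k))) = 0"
proof -
  obtain r where r: "B + int N - 1 = 2 * r" using assms(1) by (metis evenE even_diff diff_add_cancel add_diff_cancel_right' diff_diff_eq2 one_add_one)
  have "poly (1 + smult (c powi (int N - 1 - 2 * int (nat r))) [:0, 1:]) (- (c powi B)) = 0"
  proof -
    have "int N - 1 - 2 * int (nat r) = - B" using r assms(2) by simp
    then show ?thesis by (simp add: power_int_minus)
  qed
  moreover have "nat r < N" using r assms(2) by simp
  ultimately have "poly (\<Prod>i<N. 1 + smult (c powi (int N - 1 - 2 * int i)) [:0, 1:]) (- (c powi B)) = 0"
    unfolding poly_prod
    by (intro prod_zero bexI[of _ "nat r"] finite_lessThan) (simp_all only: lessThan_iff)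
  then show ?thesis
    unfolding q_binomial_theorem
    by (simp add: poly_sum power_minus[of "c powi B"] power_int_mult mult_ac)
qed


section \<open>The linearization formula\<close>

definition lin_term :: "int \<Rightarrow> int \<Rightarrow> int \<Rightarrow> int \<Rightarrow> 'a" where
  "lin_term N d e t = qbinom c N (d + e - 2 * t) * pair_qbinom (c\<^sup>2) (d + e - 2 * t) (d - t)
    * qbinom (c\<^sup>2) (N - (d + e - 2 * t)) t"

definition lin_sum :: "int \<Rightarrow> int \<Rightarrow> int \<Rightarrow> 'a" where
  "lin_sum N d e = (\<Sum>t\<in>{0..d}. lin_term N d e t)"

lemma lin_term_eq_0: "t < 0 \<or> d < t \<Longrightarrow> lin_term N d e t = 0"
  using non_root_of_unity.pair_qbinom_eq_0[OF square, of "d - t"]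
  by (auto simp: lin_term_def qbinom_neg)

text \<open>Enlarging the range absorbs the index shifts in the recurrences.\<close>

lemma lin_sum_eq:
  assumes "a \<le> 0" "d \<le> b"
  shows "lin_sum N d e = (\<Sum>t\<in>{a..b}. lin_term N d e t)"
  unfolding lin_sum_def using assms
  by (intro sum.mono_neutral_left) (auto simp: lin_term_eq_0)

text \<open>Lowering \<open>d\<close>, \<open>e\<close> and \<open>t\<close> together keeps
  \<open>j\<close> and \<open>d - t\<close>, so \<open>qbinom_sq_diff\<close> for the third factor
  and absorption for the first give the claim term by term.\<close>

lemma br_mult_lin_sum_1:
  "br c (N - d - e) * lin_sum N d e = br c N * (lin_sum (N - 1) d e - lin_sum (N - 1) (d - 1) (e - 1))"
proof -
  have termwise: "br c (N - d - e) * lin_term N d e t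
      = br c N * (lin_term (N - 1) d e t - lin_term (N - 1) (d - 1) (e - 1) (t - 1))" for t
  proof -
    define j where "j = d + e - 2 * t"
    let ?q = "qbinom (c\<^sup>2)" and ?K = "pair_qbinom (c\<^sup>2) j (d - t)"
    have j: "d - 1 + (e - 1) - 2 * (t - 1) = j" "d - 1 - (t - 1) = d - t" "N - d - e = N - j - 2 * t"
      "N - 1 - j = N - j - 1"
      by (simp_all add: j_def)
    have "br c (N - d - e) * lin_term N d e t = qbinom c N j * ?K * (br c (N - j - 2 * t) * ?q (N - j) t)"
      by (simp add: lin_term_def j flip: j_def)
    also have "\<dots> = br c (N - j) * qbinom c N j * ?K * (?q (N - j - 1) t - ?q (N - j - 1) (t - 1))"
      unfolding qbinom_sq_diff by (simp only: ac_simps)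
    also have "\<dots> = br c N * (lin_term (N - 1) d e t - lin_term (N - 1) (d - 1) (e - 1) (t - 1))"
      unfolding br_upper_mult_qbinom[symmetric] unfolding lin_term_def j j_def[symmetric] by (simp add: algebra_simps)
    finally show ?thesis .
  qed
  \<comment> \<open>The zero term at \<open>t = -1\<close> is added so that the shifted range
    becomes \<open>{0..d}\<close>.\<close>
  have "lin_sum (N - 1) (d - 1) (e - 1) = (\<Sum>t\<in>{-1..d - 1}. lin_term (N - 1) (d - 1) (e - 1) t)"
    by (rule lin_sum_eq) auto
  also have "\<dots> = (\<Sum>t\<in>{0..d}. lin_term (N - 1) (d - 1) (e - 1) (t - 1))"
    by (rule sum.reindex_bij_witness[of _ "\<lambda>t. t - 1" "\<lambda>t. t + 1"]) auto
  finally show ?thesis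
    by (simp add: lin_sum_def[of N] lin_sum_def[of _ d e] sum_distrib_left termwise flip: sum_subtractf)
qed

text \<open>Lowering \<open>N\<close> and one of \<open>d\<close>, \<open>e\<close> lowers
  \<open>j\<close> by one and keeps \<open>N - j\<close>, so the third factor is unchanged and
  \<open>pair_qbinom_sq_diff\<close> applies to the kernel.\<close>

lemma br_mult_lin_sum_2:
  "br c (d - e) * lin_sum N d e = br c N * (lin_sum (N - 1) (d - 1) e - lin_sum (N - 1) d (e - 1))"
proof -
  have termwise: "br c (d - e) * lin_term N d e t
      = br c N * (lin_term (N - 1) (d - 1) e t - lin_term (N - 1) d (e - 1) t)" for t
  proof -
    define j where "j = d + e - 2 * t"
    let ?q = "qbinom (c\<^sup>2) (N - j) t" and ?K = "pair_qbinom (c\<^sup>2)"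
    have j: "d - 1 + e - 2 * t = j - 1" "d + (e - 1) - 2 * t = j - 1" "d - e = 2 * (d - t) - j"
      "N - 1 - (j - 1) = N - j" "d - 1 - t = d - t - 1"
      by (simp_all add: j_def)
    have "br c (d - e) * lin_term N d e t = qbinom c N j * ?q * (br c (2 * (d - t) - j) * ?K j (d - t))"
      by (simp add: lin_term_def j flip: j_def)
    also have "\<dots> = br c j * qbinom c N j * ?q * (?K (j - 1) (d - t - 1) - ?K (j - 1) (d - t))"
      unfolding pair_qbinom_sq_diff by (simp only: ac_simps)
    also have "\<dots> = br c N * (lin_term (N - 1) (d - 1) e t - lin_term (N - 1) d (e - 1) t)"
      unfolding br_upper_mult_qbinom_pred[symmetric] lin_term_def j by (simp add: algebra_simps)
    finally show ?thesis .
  qed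
  have "lin_sum (N - 1) (d - 1) e = (\<Sum>t\<in>{0..d}. lin_term (N - 1) (d - 1) e t)"
    by (rule lin_sum_eq) auto
  then show ?thesis
    by (simp add: lin_sum_def[of N] lin_sum_def[of _ d] sum_distrib_left termwise flip: sum_subtractf)
qed

text \<open>After another multiplication by \<open>br c N\<close>, absorption reduces the recurrence
  to the bracket identity \<open>br\<close>, an instance of the product formula. The companion lemma
  below is proved alike.\<close>

lemma br_mult_qbinom_mult_qbinom_1:
  "br c (N - d - e) * (qbinom c N d * qbinom c N e)
    = br c N * (qbinom c (N - 1) d * qbinom c (N - 1) e - qbinom c (N - 1) (d - 1) * qbinom c (N - 1) (e - 1))"
  if "N \<noteq> 0"
proof -
  have br: "br c N * br c (N - d - e) = br c (N - d) * br c (N - e) - br c d * br c e"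
    using br_plus_minus[of c "d - e"] by (simp add: br_mult_br algebra_simps)
  have "br c N * (br c N * (qbinom c (N - 1) d * qbinom c (N - 1) e - qbinom c (N - 1) (d - 1) * qbinom c (N - 1) (e - 1)))
    = (br c N * qbinom c (N - 1) d) * (br c N * qbinom c (N - 1) e)
      - (br c N * qbinom c (N - 1) (d - 1)) * (br c N * qbinom c (N - 1) (e - 1))"
    by (simp add: algebra_simps)
  also have "\<dots> = (br c N * br c (N - d - e)) * (qbinom c N d * qbinom c N e)"
    unfolding br_upper_mult_qbinom_pred unfolding br_upper_mult_qbinom br by (simp add: algebra_simps)
  finally show ?thesis using that by (simp add: mult.assoc)
qed

lemma br_mult_qbinom_mult_qbinom_2:
  "br c (d - e) * (qbinom c N d * qbinom c N e)
    = br c N * (qbinom c (N - 1) (d - 1) * qbinom c (N - 1) e - qbinom c (N - 1) d * qbinom c (N - 1) (e - 1))"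
  if "N \<noteq> 0"
proof -
  have br: "br c N * br c (d - e) = br c d * br c (N - e) - br c (N - d) * br c e"
    using br_plus_minus[of c "N - d - e"] by (simp add: br_mult_br algebra_simps)
  have "br c N * (br c N * (qbinom c (N - 1) (d - 1) * qbinom c (N - 1) e - qbinom c (N - 1) d * qbinom c (N - 1) (e - 1)))
    = (br c N * qbinom c (N - 1) (d - 1)) * (br c N * qbinom c (N - 1) e)
      - (br c N * qbinom c (N - 1) d) * (br c N * qbinom c (N - 1) (e - 1))"
    by (simp add: algebra_simps)
  also have "\<dots> = (br c N * br c (d - e)) * (qbinom c N d * qbinom c N e)"
    unfolding br_upper_mult_qbinom_pred unfolding br_upper_mult_qbinom br by (simp add: algebra_simps)
  finally show ?thesis using that by (simp add: mult.assoc)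
qed

text \<open>On \<open>d + e = N\<close> the index \<open>j = N - 2 * t\<close> does not depend on
  \<open>i\<close>, so only the kernel is summed. That sum telescopes to zero for
  \<open>j > 0\<close>; for \<open>j < 0\<close> the first factor is zero; \<open>j = 0\<close>
  leaves the single term \<open>i = n\<close>.\<close>

lemma alternating_sum_lin_sum:
  "(\<Sum>i\<le>2 * n. (- 1) ^ i * lin_sum (int (2 * n)) (int i) (int (2 * n) - int i))
    = (- 1) ^ n * qbinom (c\<^sup>2) (int (2 * n)) (int n)"
proof -
  interpret sq: non_root_of_unity "c\<^sup>2" by (rule square)
  define N where "N = 2 * n"
  have inner: "(\<Sum>i\<le>N. (- 1) ^ i * lin_term N i (int N - int i) t)
      = (if t = int n then (- 1) ^ n * qbinom (c\<^sup>2) (int N) (int n) else 0)" if "t \<ge> 0" for t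
  proof -
    define j where "j = int N - 2 * t"
    have "(\<Sum>i\<le>N. (- 1) ^ i * lin_term N i (int N - int i) t)
      = qbinom c N j * qbinom (c\<^sup>2) (2 * t) t * (\<Sum>i\<le>N. (- 1) ^ i * pair_qbinom (c\<^sup>2) j (int i - t))"
      by (simp add: lin_term_def j_def sum_distrib_left mult_ac)
    also have "\<dots> = (if t = int n then (- 1) ^ n * qbinom (c\<^sup>2) (int N) (int n) else 0)"
    proof (cases j "0::int" rule: linorder_cases)
      case less
      then show ?thesis by (auto simp: qbinom_neg j_def N_def)
    next
      case equal
      then have t: "t = int n" by (simp add: j_def N_def)
      have "(\<Sum>i\<le>N. (- 1) ^ i * pair_qbinom (c\<^sup>2) j (int i - t)) = (\<Sum>i\<le>N. if i = n then (- 1) ^ i else 0)"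
        by (rule sum.cong) (auto simp: equal sq.pair_qbinom_0 t)
      then show ?thesis by (simp add: equal t N_def)
    next
      case greater
      have "(\<Sum>i\<le>N. (- 1) ^ i * pair_qbinom (c\<^sup>2) j (int i - t))
        = (- 1) ^ N * qbinom (c\<^sup>2) (j - 1) (int N - t) + qbinom (c\<^sup>2) (j - 1) (- 1 - t)"
        using alternating_telescope[of "\<lambda>i. qbinom (c\<^sup>2) (j - 1) (i - t)" N]
        by (simp add: pair_qbinom_def algebra_simps)
      \<comment> \<open>One lower entry is \<open>N - t = j + t\<close>, above the upper entry
        \<open>j - 1\<close>; the other is negative.\<close>
      also have "\<dots> = 0"
        using greater that qbinom_eq_0[of "nat (j - 1)" "int N - t" "c\<^sup>2"] by (simp add: qbinom_neg j_def)
      finally show ?thesis using greater by (auto simp: j_def N_def)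
    qed
    finally show ?thesis .
  qed
  have "(\<Sum>i\<le>N. (- 1) ^ i * lin_sum N i (int N - int i))
    = (\<Sum>i\<le>N. \<Sum>t\<in>{0..int N}. (- 1) ^ i * lin_term N i (int N - int i) t)"
    by (intro sum.cong refl) (simp add: lin_sum_eq[of 0 _ "int N"] sum_distrib_left)
  also have "\<dots> = (\<Sum>t\<in>{0..int N}. \<Sum>i\<le>N. (- 1) ^ i * lin_term N i (int N - int i) t)"
    by (rule sum.swap)
  also have "\<dots> = (\<Sum>t\<in>{0..int N}. if t = int n then (- 1) ^ n * qbinom (c\<^sup>2) (int N) (int n) else 0)"
    by (intro sum.cong refl) (simp add: inner)
  also have "\<dots> = (- 1) ^ n * qbinom (c\<^sup>2) (int N) (int n)"
    by (simp add: N_def)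
  finally show ?thesis by (simp add: N_def)
qed

text \<open>A recurrence determines the value wherever its bracket is nonzero: the second for
  \<open>d \<noteq> e\<close>, the first for \<open>d + e \<noteq> N\<close>. The alternating sums
  isolate the one remaining value.\<close>

lemma qbinom_linearization: "lin_sum (int N) d e = qbinom c (int N) d * qbinom c (int N) e"
proof (induction N arbitrary: d e)
  case 0
  show ?case
  proof (cases "0 \<le> d")
    case True
    interpret sq: non_root_of_unity "c\<^sup>2" by (rule square)
    have "lin_sum 0 d e = (\<Sum>t\<in>{0..d}. if t = 0 then (if d = 0 \<and> e = 0 then 1 else 0) else 0)"
      unfolding lin_sum_def
      by (intro sum.cong refl) (auto simp: lin_term_def qbinom_zero_left sq.pair_qbinom_0)
    with True show ?thesis by (simp add: qbinom_zero_left)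
  qed (simp add: lin_sum_def qbinom_neg)
next
  case (Suc M)
  define N where "N = Suc M"
  have M: "int N - 1 = int M" and N0: "int N \<noteq> 0" by (simp_all add: N_def)
  have off_diagonal: "lin_sum (int N) d e = qbinom c (int N) d * qbinom c (int N) e" if "d \<noteq> e" for d e
  proof -
    have "br c (d - e) * lin_sum (int N) d e = br c (d - e) * (qbinom c (int N) d * qbinom c (int N) e)"
      unfolding br_mult_lin_sum_2 br_mult_qbinom_mult_qbinom_2[OF N0] M Suc.IH ..
    with that show ?thesis by simp
  qed
  have "lin_sum (int N) d e = qbinom c (int N) d * qbinom c (int N) e" if "d + e \<noteq> int N"
  proof -
    have "br c (int N - d - e) * lin_sum (int N) d e = br c (int N - d - e) * (qbinom c (int N) d * qbinom c (int N) e)"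
      unfolding br_mult_lin_sum_1 br_mult_qbinom_mult_qbinom_1[OF N0] M Suc.IH ..
    with that show ?thesis by simp
  qed
  moreover have "lin_sum (int N) d e = qbinom c (int N) d * qbinom c (int N) e" if "d + e = int N" "d = e"
  proof -
    define n where "n = nat d"
    have n: "d = int n" "e = int n" "N = 2 * n" using that by (simp_all add: n_def)
    let ?f = "\<lambda>i. lin_sum (int N) (int i) (int N - int i) - qbinom c (int N) (int i) * qbinom c (int N) (int N - int i)"
    have "0 = (\<Sum>i\<le>N. (- 1) ^ i * ?f i)"
      using alternating_sum_lin_sum[of n] alternating_sum_qbinom_squares[of n]
      by (simp add: n(3) right_diff_distrib sum_subtractf)
    \<comment> \<open>For \<open>i \<noteq> n\<close> the two lower indices differ, so
      \<open>off_diagonal\<close> applies.\<close>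
    also have "\<dots> = (\<Sum>i\<le>N. if i = n then (- 1) ^ i * ?f i else 0)"
    proof (rule sum.cong)
      fix i
      show "(- 1) ^ i * ?f i = (if i = n then (- 1) ^ i * ?f i else 0)"
        using off_diagonal[of "int i" "int N - int i"] n(3) by auto
    qed simp
    also have "\<dots> = (- 1) ^ n * ?f n" by (simp add: n(3))
    finally show ?thesis by (simp add: n)
  qed
  ultimately show ?case using off_diagonal unfolding N_def by blast
qed


section \<open>From double sums to single sums over one parity class\<close>

text \<open>With \<open>j = 2 * k + p\<close>, \<open>e = j + d - 2 * s\<close> and
  \<open>t = d - s\<close>, the sum over \<open>s\<close> for fixed \<open>e\<close> is
  \<open>lin_sum N d e\<close>. The set \<open>I\<close> only has to cover the support, which
  accommodates the different ranges in the identities.\<close>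

lemma linearized_sum:
  fixes \<phi> :: "int \<Rightarrow> 'a" and I :: "(nat \<times> nat) set"
  assumes "finite I" "p \<le> 1"
    and I: "\<And>k s. 2 * k + p \<le> N \<Longrightarrow> s \<le> d \<Longrightarrow> s \<le> 2 * k + p \<Longrightarrow> (k, s) \<in> I"
  shows "(\<Sum>(k, s)\<in>I. \<phi> (2 * int k + int p + int d - 2 * int s)
      * (qbinom c (int N) (2 * int k + int p) * pair_qbinom (c\<^sup>2) (2 * int k + int p) (int s)
        * qbinom (c\<^sup>2) (int N - (2 * int k + int p)) (int d - int s)))
    = qbinom c (int N) (int d) * (\<Sum>e | e \<le> N \<and> even (e + d + p). \<phi> (int e) * qbinom c (int N) (int e))"
proof -
  interpret sq: non_root_of_unity "c\<^sup>2" by (rule square)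
  define u where "u j s = qbinom c (int N) j * pair_qbinom (c\<^sup>2) j (int s)
    * qbinom (c\<^sup>2) (int N - j) (int d - int s)" for j s
  \<comment> \<open>These bounds make the natural-number subtractions in the reindexing below
    exact.\<close>
  have u_nonzero: "0 \<le> j \<and> j \<le> int N \<and> int s \<le> j \<and> s \<le> d \<and> int d - int s \<le> int N - j" if "u j s \<noteq> 0" for j s
  proof -
    have "0 \<le> j" "j \<le> int N"
      using that qbinom_neg[of j c] qbinom_eq_0[of N j c] by (force simp: u_def)+
    moreover have "int s \<le> j"
      using that sq.pair_qbinom_eq_0[of "int s" j] \<open>0 \<le> j\<close> by (force simp: u_def)
    moreover have "s \<le> d"
      using that qbinom_neg[of "int d - int s" "c\<^sup>2"] by (force simp: u_def)
    moreover have "int d - int s \<le> int N - j"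
      using that qbinom_eq_0[of "nat (int N - j)" "int d - int s" "c\<^sup>2"] \<open>j \<le> int N\<close> by (force simp: u_def)
    ultimately show ?thesis by simp
  qed
  let ?g = "\<lambda>(k, s). \<phi> (2 * int k + int p + int d - 2 * int s) * u (2 * int k + int p) s"
  let ?h = "\<lambda>(e, s). \<phi> (int e) * u (int e - int d + 2 * int s) s"
  let ?E = "{e. e \<le> N \<and> even (e + d + p)}"
  \<comment> \<open>The reindexing is a bijection between the supports only, so zero terms are
    dropped first and restored afterwards.\<close>
  have "(\<Sum>x\<in>I. ?g x) = (\<Sum>x\<in>{x\<in>I. ?g x \<noteq> 0}. ?g x)"
    using \<open>finite I\<close> by (intro sum.mono_neutral_right) auto
  also have "\<dots> = (\<Sum>x\<in>{x\<in>?E \<times> {..d}. ?h x \<noteq> 0}. ?h x)"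
  proof (rule sum.reindex_bij_witness[of _
      "\<lambda>(e, s). ((e + 2 * s - d) div 2, s)" "\<lambda>(k, s). (2 * k + p + d - 2 * s, s)"])
    fix x assume x: "x \<in> {x\<in>I. ?g x \<noteq> 0}"
    obtain k s where ks: "x = (k, s)" by force
    have *: "2 * k + p \<le> N" "s \<le> 2 * k + p" "s \<le> d" "d + (2 * k + p) \<le> N + s"
      using x u_nonzero[of "2 * int k + int p" s] unfolding ks by (auto; linarith)+
    define e where "e = 2 * k + p + d - 2 * s"
    have e: "int e = 2 * int k + int p + int d - 2 * int s" "e + 2 * s = 2 * k + p + d"
      using * by (auto simp: e_def)
    have "even (e + d + p)" using e(2) by presburger
    moreover have "e \<le> N" using e * by linarith
    ultimately show "(case x of (k, s) \<Rightarrow> (2 * k + p + d - 2 * s, s)) \<in> {x\<in>?E \<times> {..d}. ?h x \<noteq> 0}"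
      using x * by (simp add: ks e(1) flip: e_def)
    show "?h (case x of (k, s) \<Rightarrow> (2 * k + p + d - 2 * s, s)) = ?g x"
      by (simp add: ks e(1) flip: e_def)
    \<comment> \<open>The dividend is \<open>2 * k + p\<close> with \<open>p \<le> 1\<close>, so the
      division discards \<open>p\<close>.\<close>
    have "(e + 2 * s - d) div 2 = k" using e(2) \<open>p \<le> 1\<close> by simp
    then show "(case (case x of (k, s) \<Rightarrow> (2 * k + p + d - 2 * s, s)) of (e, s) \<Rightarrow> ((e + 2 * s - d) div 2, s)) = x"
      by (simp add: ks flip: e_def)
  next
    fix y assume y: "y \<in> {x\<in>?E \<times> {..d}. ?h x \<noteq> 0}"
    obtain e s where es: "y = (e, s)" by force
    have *: "d \<le> e + 2 * s" "e + 2 * s \<le> N + d" "s \<le> e + 2 * s - d" "s \<le> d" "even (e + d + p)"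
      using y u_nonzero[of "int e - int d + 2 * int s" s] unfolding es by (auto; linarith)+
    define k where "k = (e + 2 * s - d) div 2"
    have k: "2 * k + p = e + 2 * s - d"
      using *(1,5) \<open>p \<le> 1\<close> unfolding k_def by presburger
    then have k': "2 * int k + int p = int e - int d + 2 * int s" using *(1) by linarith
    have e: "2 * k + p + d - 2 * s = e" using k * by linarith
    show "(case y of (e, s) \<Rightarrow> ((e + 2 * s - d) div 2, s)) \<in> {x\<in>I. ?g x \<noteq> 0}"
      using y * k I[of k s] by (simp add: es k' flip: k_def)
    show "(case (case y of (e, s) \<Rightarrow> ((e + 2 * s - d) div 2, s)) of (k, s) \<Rightarrow> (2 * k + p + d - 2 * s, s)) = y"
      using e by (simp add: es flip: k_def)
  qed
  also have "\<dots> = (\<Sum>x\<in>?E \<times> {..d}. ?h x)"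
    by (intro sum.mono_neutral_left) auto
  also have "\<dots> = (\<Sum>e\<in>?E. \<phi> (int e) * (\<Sum>s\<le>d. u (int e - int d + 2 * int s) s))"
    by (simp add: sum.cartesian_product sum_distrib_left)
  also have "\<dots> = (\<Sum>e\<in>?E. \<phi> (int e) * (qbinom c (int N) (int d) * qbinom c (int N) (int e)))"
  proof (intro sum.cong refl arg_cong2[where f = "(*)"])
    fix e
    have "(\<Sum>s\<le>d. u (int e - int d + 2 * int s) s) = lin_sum (int N) (int d) (int e)"
      unfolding lin_sum_def
      by (rule sum.reindex_bij_witness[of _ "\<lambda>t. nat (int d - t)" "\<lambda>s. int d - int s"])
        (auto simp: u_def lin_term_def algebra_simps)
    then show "(\<Sum>s\<le>d. u (int e - int d + 2 * int s) s) = qbinom c (int N) (int d) * qbinom c (int N) (int e)"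
      by (simp add: qbinom_linearization)
  qed
  finally show ?thesis
    by (simp add: u_def sum_distrib_left mult_ac)
qed

section \<open>Reflection and the single sums\<close>

lemma sum_reflect_qbinom:
  "(\<Sum>e | e \<le> N \<and> even (e + q). g (int e) * qbinom c (int N) (int e))
    = (\<Sum>e | e \<le> N \<and> even (e + N + q). g (int N - int e) * qbinom c (int N) (int e))"
  by (rule sum.reindex_bij_witness[of _ "\<lambda>e. N - e" "\<lambda>e. N - e"])
    (auto simp: of_nat_diff qbinom_symmetric)

text \<open>The vanishing alternating sum equates this sum \<open>S\<close> with the one over the
  other parity class. For odd \<open>N\<close> reflection returns to the original class and changes
  the sign of the weight, so \<open>S = - S\<close>; characteristic 2 is excluded for this
  reason.\<close>

lemma odd_sum_eq_0:
  assumes "odd N" "2 * \<bar>b\<bar> < int N" "(2::'a) \<noteq> 0"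
  shows "(\<Sum>e | e \<le> N \<and> even (e + q). qint c (b * (int N - 2 * int e)) * qbinom c (int N) (int e)) = 0"
proof -
  let ?f = "\<lambda>e. br c (b * (int N - 2 * int e)) * qbinom c (int N) (int e)"
  have "(\<Sum>e\<le>N. (- 1) ^ e * ?f e)
    = c powi (b * int N) * (\<Sum>e\<le>N. (- 1) ^ e * (c powi (- 2 * b * int e) * qbinom c (int N) (int e)))
      - c powi (- b * int N) * (\<Sum>e\<le>N. (- 1) ^ e * (c powi (2 * b * int e) * qbinom c (int N) (int e)))"
    unfolding sum_distrib_left sum_subtractf[symmetric]
  proof (rule sum.cong)
    fix e
    have "c powi (b * (int N - 2 * int e)) = c powi (b * int N) * c powi (- 2 * b * int e)"
      "c powi (- (b * (int N - 2 * int e))) = c powi (- b * int N) * c powi (2 * b * int e)"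
      by (simp_all add: algebra_simps flip: power_int_add)
    then show "(- 1) ^ e * ?f e = c powi (b * int N) * ((- 1) ^ e * (c powi (- 2 * b * int e) * qbinom c (int N) (int e)))
      - c powi (- b * int N) * ((- 1) ^ e * (c powi (2 * b * int e) * qbinom c (int N) (int e)))"
      unfolding br_def by (simp add: algebra_simps)
  qed simp
  also have "\<dots> = 0"
    using assms(1,2) q_binomial_vanishing[of "- 2 * b" N] q_binomial_vanishing[of "2 * b" N] by simp
  finally have "(\<Sum>e | e \<le> N \<and> even (e + q). ?f e) = (\<Sum>e | e \<le> N \<and> odd (e + q). ?f e)"
    by (rule sum_even_eq_sum_odd)
  also have "\<dots> = (\<Sum>e | e \<le> N \<and> even (e + Suc q). ?f e)" by simp
  also have "\<dots> = (\<Sum>e | e \<le> N \<and> even (e + N + Suc q). br c (b * (int N - 2 * (int N - int e))) * qbinom c (int N) (int e))"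
    by (rule sum_reflect_qbinom)
  also have "\<dots> = - (\<Sum>e | e \<le> N \<and> even (e + q). ?f e)"
    unfolding sum_negf[symmetric]
  proof (rule sum.cong)
    show "{e. e \<le> N \<and> even (e + N + Suc q)} = {e. e \<le> N \<and> even (e + q)}" using assms(1) by auto
    fix e
    have "b * (int N - 2 * (int N - int e)) = - (b * (int N - 2 * int e))" by (simp add: algebra_simps)
    then show "br c (b * (int N - 2 * (int N - int e))) * qbinom c (int N) (int e) = - ?f e"
      by (simp only: br_minus) simp
  qed
  finally have "2 * (\<Sum>e | e \<le> N \<and> even (e + q). ?f e) = 0"
    by (simp only: mult_2) (simp add: eq_neg_iff_add_eq_0)
  with assms(3) have "(\<Sum>e | e \<le> N \<and> even (e + q). ?f e) = 0" by simp
  then show ?thesis by (simp add: qint_eq_br sum_divide_distrib[symmetric])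
qed

text \<open>For even \<open>N\<close> reflection keeps the parity class and exchanges the two
  weights; the vanishing alternating sum then exchanges the classes.\<close>

lemma even_sum_eq:
  assumes "even N" "odd B" "\<bar>B\<bar> < int N"
  shows "(\<Sum>e | e \<le> N \<and> even (e + d + 1). c powi (B * (int N - int d - int e)) * qbinom c (int N) (int e))
    = (\<Sum>e | e \<le> N \<and> even (e + d + 0). c powi (B * (int e - int d)) * qbinom c (int N) (int e))"
proof -
  let ?f = "\<lambda>e. c powi (B * (int e - int d)) * qbinom c (int N) (int e)"
  have "(\<Sum>e\<le>N. (- 1) ^ e * ?f e)
    = c powi (- B * int d) * (\<Sum>e\<le>N. (- 1) ^ e * (c powi (B * int e) * qbinom c (int N) (int e)))"
    unfolding sum_distrib_left
  proof (rule sum.cong)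
    fix e
    have "c powi (B * (int e - int d)) = c powi (- B * int d) * c powi (B * int e)"
      by (simp add: algebra_simps flip: power_int_add)
    then show "(- 1) ^ e * ?f e = c powi (- B * int d) * ((- 1) ^ e * (c powi (B * int e) * qbinom c (int N) (int e)))"
      by simp
  qed simp
  then have "(\<Sum>e\<le>N. (- 1) ^ e * ?f e) = 0"
    using assms q_binomial_vanishing[of B N] by simp
  then have "(\<Sum>e | e \<le> N \<and> even (e + d). ?f e) = (\<Sum>e | e \<le> N \<and> odd (e + d). ?f e)"
    by (rule sum_even_eq_sum_odd)
  also have "\<dots> = (\<Sum>e | e \<le> N \<and> even (e + N + (d + 1)). c powi (B * (int N - (int N - int e) - int d)) * qbinom c (int N) (int e))"
    using assms(1) by (intro sum.cong) auto
  also have "\<dots> = (\<Sum>e | e \<le> N \<and> even (e + (d + 1)). c powi (B * (int N - int e - int d)) * qbinom c (int N) (int e))"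
    by (rule sum_reflect_qbinom[symmetric])
  finally show ?thesis by (simp add: algebra_simps)
qed

end

section \<open>Specialization to powers of the indeterminate\<close>

lemma v_indet_power: "v_indet ^ n = Fract ([:0, 1:] ^ n) 1"
  by (induction n) (simp_all add: v_indet_def One_fract_def)

text \<open>A power equal to 1 would force the polynomial \<open>[:0, 1:] ^ (d * n)\<close> to be 1,
  against its positive degree.\<close>

lemma non_root_of_unity_v_indet_power:
  assumes "d > 0" shows "non_root_of_unity (v_indet ^ d)"
proof
  show "v_indet ^ d \<noteq> 0"
    by (simp add: v_indet_power Zero_fract_def eq_fract)
  fix n :: nat assume "n > 0"
  have "([:0, 1:] :: rat poly) ^ (d * n) \<noteq> 1"
    using assms \<open>n > 0\<close> degree_linear_power[of "0::rat" "d * n"] by (metis degree_1 mult_eq_0_iff neq0_conv)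
  then show "(v_indet ^ d) ^ n \<noteq> 1"
    unfolding power_mult[symmetric] unfolding v_indet_power by (simp add: One_fract_def eq_fract)
qed

lemma two_ratfun_neq_0: "(2 :: ratfun) \<noteq> 0"
  unfolding one_add_one[symmetric] by (simp add: One_fract_def Zero_fract_def eq_fract)


theorem proposition6p1:
  fixes m d :: nat and vi :: ratfun
  assumes "d > 0" and "vi = v_indet ^ d"
  shows
    "(\<forall>b l :: int. 0 \<le> \<bar>b\<bar> \<and> \<bar>b\<bar> \<le> int m \<and> 0 \<le> l \<and> l \<le> int m \<longrightarrow>
        (\<Sum>k=0..m. \<Sum>s=0..2*k.
           qint vi (b * (2 * l + 1 - 4 * int k + 4 * int s))
           * qbinom vi (2 * int m + 1) (2 * int k)
           * (qbinom (vi ^ 2) (2 * int k - 1) (int s) + qbinom (vi ^ 2) (2 * int k - 1) (int s - 1))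
           * qbinom (vi ^ 2) (2 * int m - 2 * int k + 1) (int m - l - int s)) = 0)
   \<and> (\<forall>b l :: int. 0 \<le> \<bar>b\<bar> \<and> \<bar>b\<bar> \<le> int m \<and> 0 \<le> l \<and> l \<le> int m \<longrightarrow>
        (\<Sum>k=0..m. \<Sum>s=0..2*k+1.
           qint vi (b * (2 * l - 1 - 4 * int k + 4 * int s))
           * qbinom vi (2 * int m + 1) (2 * int k + 1)
           * (qbinom (vi ^ 2) (2 * int k) (int s) + qbinom (vi ^ 2) (2 * int k) (int s - 1))
           * qbinom (vi ^ 2) (2 * int m - 2 * int k) (int m - l - int s)) = 0)
   \<and> (\<forall>b l :: int. - (int m + 1) \<le> b \<and> b \<le> int m \<and> 0 \<le> l \<and> l \<le> int m \<longrightarrow>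
        Sum_any (\<lambda>(k :: nat, s :: nat).
           vi powi ((2 * b + 1) * (2 * l - 2 * int k + 2 * int s + 1))
           * qbinom vi (2 * int m + 2) (2 * int k + 1)
           * (qbinom (vi ^ 2) (2 * int k) (int s) + qbinom (vi ^ 2) (2 * int k) (int s - 1))
           * qbinom (vi ^ 2) (2 * int m - 2 * int k + 1) (int m - l - int s))
        = Sum_any (\<lambda>(k :: nat, s :: nat).
           vi powi ((2 * b + 1) * (2 * int k - 2 * int s))
           * qbinom vi (2 * int m + 2) (2 * int k)
           * (qbinom (vi ^ 2) (2 * int k - 1) (int s) + qbinom (vi ^ 2) (2 * int k - 1) (int s - 1))
           * qbinom (vi ^ 2) (2 * int m - 2 * int k + 2) (int m - l - int s)))"
proof -
  interpret non_root_of_unity vi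
    unfolding assms(2) using assms(1) by (rule non_root_of_unity_v_indet_power)
  show ?thesis
  proof (intro conjI allI impI; elim conjE)
    fix b l :: int
    assume b: "\<bar>b\<bar> \<le> int m" and l: "0 \<le> l" "l \<le> int m"
    \<comment> \<open>From here \<open>d\<close> is the lower index of the overview and hides the
      exponent in \<open>vi = v_indet ^ d\<close>.\<close>
    define d where "d = nat (int m - l)"
    have l_eq: "l = int m - int d" using l by (simp add: d_def)
    let ?N = "2 * m + 1"
    \<comment> \<open>For \<open>e = 2 * k + p + d - 2 * s\<close> the weight argument
      \<open>N - 2 * e\<close> is \<open>2 * l + 1 - 2 * p - 4 * k + 4 * s\<close>;
      \<open>p = 0\<close> and \<open>p = 1\<close> give the first two identities.\<close>
    have vanish: "(\<Sum>k=0..m. \<Sum>s=0..2 * k + p. qint vi (b * (int ?N - 2 * (2 * int k + int p + int d - 2 * int s)))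
        * (qbinom vi (int ?N) (2 * int k + int p) * pair_qbinom (vi\<^sup>2) (2 * int k + int p) (int s)
          * qbinom (vi\<^sup>2) (int ?N - (2 * int k + int p)) (int d - int s))) = 0" if "p \<le> 1" for p
      using linearized_sum[of "Sigma {0..m} (\<lambda>k. {0..2 * k + p})" p ?N d "\<lambda>e. qint vi (b * (int ?N - 2 * e))"]
        odd_sum_eq_0[of ?N b "d + p"] that b two_ratfun_neq_0 by (simp add: sum.Sigma add.assoc)
    show "(\<Sum>k=0..m. \<Sum>s=0..2*k.
           qint vi (b * (2 * l + 1 - 4 * int k + 4 * int s))
           * qbinom vi (2 * int m + 1) (2 * int k)
           * (qbinom (vi ^ 2) (2 * int k - 1) (int s) + qbinom (vi ^ 2) (2 * int k - 1) (int s - 1))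
           * qbinom (vi ^ 2) (2 * int m - 2 * int k + 1) (int m - l - int s)) = 0"
      by (intro trans[OF _ vanish[of 0]] sum.cong) (simp_all add: l_eq pair_qbinom_def algebra_simps)
    show "(\<Sum>k=0..m. \<Sum>s=0..2*k+1.
           qint vi (b * (2 * l - 1 - 4 * int k + 4 * int s))
           * qbinom vi (2 * int m + 1) (2 * int k + 1)
           * (qbinom (vi ^ 2) (2 * int k) (int s) + qbinom (vi ^ 2) (2 * int k) (int s - 1))
           * qbinom (vi ^ 2) (2 * int m - 2 * int k) (int m - l - int s)) = 0"
      by (intro trans[OF _ vanish[of 1]] sum.cong) (simp_all add: l_eq pair_qbinom_def algebra_simps)
  next
    fix b l :: int
    assume b: "- (int m + 1) \<le> b" "b \<le> int m" and l: "0 \<le> l" "l \<le> int m"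
    define d where "d = nat (int m - l)"
    have l_eq: "l = int m - int d" using l by (simp add: d_def)
    define N where "N = 2 * m + 2"
    \<comment> \<open>The bounds on \<open>b\<close> amount to \<open>\<bar>B\<bar> < N\<close>, as
      the vanishing sum requires.\<close>
    define B where "B = 2 * b + 1"
    let ?I = "{..N} \<times> {..d}"
    have to_finite_sum: "Sum_any (\<lambda>(k, s). F k s) = (\<Sum>(k, s)\<in>?I. F k s)"
      if "\<And>k s. F k s \<noteq> 0 \<Longrightarrow> k \<le> N \<and> s \<le> d" for F :: "nat \<Rightarrow> nat \<Rightarrow> ratfun"
      using that by (intro Sum_any.expand_superset) auto
    have nonzeroD: "k \<le> N \<and> s \<le> d"
      if "x * qbinom vi (2 * int m + 2) (2 * int k + int p) * y * qbinom (vi\<^sup>2) z (int m - l - int s) \<noteq> 0"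
      for x y z k s and p :: nat
    proof -
      have "\<not> int N < 2 * int k + int p" "\<not> int m - l - int s < 0"
        using that qbinom_eq_0[of N "2 * int k + int p" vi] qbinom_neg[of "int m - l - int s" "vi\<^sup>2" z]
        by (auto simp: N_def add.commute)
      then show ?thesis unfolding l_eq by linarith
    qed
    have lin: "(\<Sum>(k, s)\<in>?I. \<phi> (2 * int k + int p + int d - 2 * int s)
        * (qbinom vi (int N) (2 * int k + int p) * pair_qbinom (vi\<^sup>2) (2 * int k + int p) (int s)
          * qbinom (vi\<^sup>2) (int N - (2 * int k + int p)) (int d - int s)))
      = qbinom vi (int N) (int d) * (\<Sum>e | e \<le> N \<and> even (e + d + p). \<phi> (int e) * qbinom vi (int N) (int e))"
      if "p \<le> 1" for p \<phi>
      using that by (intro linearized_sum) auto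
    \<comment> \<open>With \<open>e\<close> as before, the exponents are
      \<open>B * (N - d - e)\<close> on this side (\<open>p = 1\<close>) and
      \<open>B * (e - d)\<close> on the other (\<open>p = 0\<close>).\<close>
    have "Sum_any (\<lambda>(k :: nat, s :: nat).
           vi powi ((2 * b + 1) * (2 * l - 2 * int k + 2 * int s + 1))
           * qbinom vi (2 * int m + 2) (2 * int k + 1)
           * (qbinom (vi ^ 2) (2 * int k) (int s) + qbinom (vi ^ 2) (2 * int k) (int s - 1))
           * qbinom (vi ^ 2) (2 * int m - 2 * int k + 1) (int m - l - int s))
      = (\<Sum>(k, s)\<in>?I. vi powi (B * (int N - int d - (2 * int k + int 1 + int d - 2 * int s)))
        * (qbinom vi (int N) (2 * int k + int 1) * pair_qbinom (vi\<^sup>2) (2 * int k + int 1) (int s)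
          * qbinom (vi\<^sup>2) (int N - (2 * int k + int 1)) (int d - int s)))"
      by (subst to_finite_sum, rule nonzeroD[of _ _ 1], simp, intro sum.cong refl)
        (auto simp: l_eq N_def B_def pair_qbinom_def algebra_simps)
    also have "\<dots> = (\<Sum>(k, s)\<in>?I. vi powi (B * (2 * int k + int 0 + int d - 2 * int s - int d))
        * (qbinom vi (int N) (2 * int k + int 0) * pair_qbinom (vi\<^sup>2) (2 * int k + int 0) (int s)
          * qbinom (vi\<^sup>2) (int N - (2 * int k + int 0)) (int d - int s)))"
      using lin[of 1 "\<lambda>e. vi powi (B * (int N - int d - e))"] lin[of 0 "\<lambda>e. vi powi (B * (e - int d))"]
        even_sum_eq[of N B d] b by (simp add: N_def B_def)
    also have "\<dots> = Sum_any (\<lambda>(k :: nat, s :: nat).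
           vi powi ((2 * b + 1) * (2 * int k - 2 * int s))
           * qbinom vi (2 * int m + 2) (2 * int k)
           * (qbinom (vi ^ 2) (2 * int k - 1) (int s) + qbinom (vi ^ 2) (2 * int k - 1) (int s - 1))
           * qbinom (vi ^ 2) (2 * int m - 2 * int k + 2) (int m - l - int s))"
      by (subst to_finite_sum, rule nonzeroD[of _ _ 0], simp, intro sum.cong refl)
        (auto simp: l_eq N_def B_def pair_qbinom_def algebra_simps)
    finally show "Sum_any (\<lambda>(k :: nat, s :: nat).
           vi powi ((2 * b + 1) * (2 * l - 2 * int k + 2 * int s + 1))
           * qbinom vi (2 * int m + 2) (2 * int k + 1)
           * (qbinom (vi ^ 2) (2 * int k) (int s) + qbinom (vi ^ 2) (2 * int k) (int s - 1))
           * qbinom (vi ^ 2) (2 * int m - 2 * int k + 1) (int m - l - int s))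
        = Sum_any (\<lambda>(k :: nat, s :: nat).
           vi powi ((2 * b + 1) * (2 * int k - 2 * int s))
           * qbinom vi (2 * int m + 2) (2 * int k)
           * (qbinom (vi ^ 2) (2 * int k - 1) (int s) + qbinom (vi ^ 2) (2 * int k - 1) (int s - 1))
           * qbinom (vi ^ 2) (2 * int m - 2 * int k + 2) (int m - l - int s))" .
  qed
qed

end
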